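(* Let $\boldsymbol v\in\mathbb R_+^M$ and $\boldsymbol W\in\mathbb R_+^{M\times R}$. Let $g_r:\mathbb R_+\to\mathbb R_+$, $r=1,\dots,R$, be a collection of functions such that for all $\boldsymbol h,\tilde{\boldsymbol h}\in\mathbb R_+^R$ it holds that $$D_{\mathrm{KL}}(\boldsymbol v\Vert \boldsymbol W\boldsymbol h)\ \le\ \sum_{r=1}^R g_r(h_r)\ \le\ UB_{MU}(\boldsymbol h,\tilde{\boldsymbol h}).$$ Then for all $\boldsymbol h,\tilde{\boldsymbol h}\in\mathbb R_+^R$ $$\sum_{r=1}^R g_r(h_r)=UB_{MU}(\boldsymbol h,\tilde{\boldsymbol h}).$$ In other words, $UB_{MU}$ is the tightest separable global majorant of the loss function $\boldsymbol h\mapsto D_{\mathrm{KL}}(\boldsymbol v\Vert\boldsymbol W\boldsymbol h)$.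
   Context: $\mathbb R_+$ denotes the nonnegative reals. The Kullback-Leibler divergence between $\boldsymbol v\in\mathbb R_+^M$ and $\boldsymbol W\boldsymbol h$, with $\boldsymbol W\in\mathbb R_+^{M\times R}$ and $\boldsymbol h\in\mathbb R_+^R$, is $$D_{\mathrm{KL}}(\boldsymbol v\Vert\boldsymbol W\boldsymbol h)=\sum_{i=1}^M\Big(v_i\log v_i-v_i+(\boldsymbol W\boldsymbol h)_i-v_i\log (\boldsymbol W\boldsymbol h)_i\Big),$$ with the conventions $0\log 0=0$ and $a\log 0=-\infty$ for $a>0$. The multiplicative-updates (MU) upper bound of this loss, obtained from Jensen's inequality at a current iterate $\tilde{\boldsymbol h}$, is $$UB_{MU}(\boldsymbol h,\tilde{\boldsymbol h})=\sum_{i=1}^M\Big(v_i\log v_i-v_i+(\boldsymbol W\boldsymbol h)_i-v_i\sum_{r=1}^R\alpha_{i,r}\log\frac{W_{i,r}h_r}{\alpha_{i,r}}\Big),\qquad \alpha_{i,r}=\frac{W_{i,r}\tilde h_r}{(\boldsymbol W\tilde{\boldsymbol h})_i}.$$ A function of $\boldsymbol h$ is separable if it is a sum of functions each depending on a single entry $h_r$. *)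

theory Defs
  imports "HOL-Analysis.Analysis"
begin

definition nonneg_orthant :: "(real ^ 'n) set" where
  "nonneg_orthant = {x. \<forall>j. 0 \<le> x $ j}"

(* Together with the ereal conventions 0 * (-\<infinity>) = 0 and a * (-\<infinity>) = -\<infinity> for a > 0,
   this gives 0 log 0 = 0 and a log 0 = -\<infinity>. It is only meant for x \<ge> 0. *)
definition elog :: "real \<Rightarrow> ereal" where
  "elog x = (if x \<le> 0 then -\<infinity> else ereal (ln x))"

(* Takes values in [0, \<infinity>] for nonnegative data: the only possibly infinite term of a summand is the
   last one, so \<infinity> - \<infinity> does not occur. *)
definition KL_div :: "real ^ 'm \<Rightarrow> real ^ 'r ^ 'm \<Rightarrow> real ^ 'r \<Rightarrow> ereal" where
  "KL_div v W h =
    (\<Sum>i\<in>UNIV. ereal (v $ i) * elog (v $ i) - ereal (v $ i) + ereal ((W *v h) $ i)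
       - ereal (v $ i) * elog ((W *v h) $ i))"

definition MU_weight :: "real ^ 'r ^ 'm \<Rightarrow> real ^ 'r \<Rightarrow> 'm \<Rightarrow> 'r \<Rightarrow> real" where
  "MU_weight W h' i r = W $ i $ r * h' $ r / (W *v h') $ i"

(* h' is the current iterate. A zero weight contributes nothing to the inner sum, since
   0 * elog _ = 0. If (W h')_i = 0 the weights of row i are the undefined 0/0 of the formula (here 0);
   this matters only if v_i > 0, see MU_admissible. *)
definition UB_MU :: "real ^ 'm \<Rightarrow> real ^ 'r ^ 'm \<Rightarrow> real ^ 'r \<Rightarrow> real ^ 'r \<Rightarrow> ereal" where
  "UB_MU v W h h' =
    (\<Sum>i\<in>UNIV. ereal (v $ i) * elog (v $ i) - ereal (v $ i) + ereal ((W *v h) $ i)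
       - ereal (v $ i) *
         (\<Sum>r\<in>UNIV. ereal (MU_weight W h' i r) *
            elog (W $ i $ r * h $ r / MU_weight W h' i r)))"

(* The iterates at which every weight that enters UB_MU with a positive factor v_i is defined;
   equivalently, those of finite loss. All iterates are admissible if v = 0. *)
definition MU_admissible :: "real ^ 'm \<Rightarrow> real ^ 'r ^ 'm \<Rightarrow> real ^ 'r \<Rightarrow> bool" where
  "MU_admissible v W h' \<longleftrightarrow> h' \<in> nonneg_orthant \<and> (\<forall>i. 0 < v $ i \<longrightarrow> 0 < (W *v h') $ i)"

(* Summands take values in (-\<infinity>, \<infinity>]: the value \<infinity> is needed because the loss and UB_MU attain it on
   the boundary of the orthant, and -\<infinity> is excluded so that the sums are well defined. *)
definition separable :: "(real ^ 'r \<Rightarrow> ereal) \<Rightarrow> bool" where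
  "separable F \<longleftrightarrow>
    (\<exists>f :: 'r \<Rightarrow> real \<Rightarrow> ereal. (\<forall>r. \<forall>x\<ge>0. f r x \<noteq> -\<infinity>) \<and>
       (\<forall>h\<in>nonneg_orthant. F h = (\<Sum>r\<in>UNIV. f r (h $ r))))"

definition global_majorant :: "(real ^ 'r \<Rightarrow> ereal) \<Rightarrow> (real ^ 'r \<Rightarrow> ereal) \<Rightarrow> bool" where
  "global_majorant D F \<longleftrightarrow> (\<forall>h\<in>nonneg_orthant. D h \<le> F h)"

definition tightest_separable_majorant ::
    "(real ^ 'r \<Rightarrow> ereal) \<Rightarrow> (real ^ 'r \<Rightarrow> ereal) \<Rightarrow> bool" where
  "tightest_separable_majorant D U \<longleftrightarrow>
     separable U \<and> global_majorant D U \<and>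
     (\<forall>F. separable F \<and> global_majorant D F \<and> (\<forall>h\<in>nonneg_orthant. F h \<le> U h)
        \<longrightarrow> (\<forall>h\<in>nonneg_orthant. F h = U h))"

end

theory Submission imports Defs begin

text \<open>The upper bound and the loss agree on the whole ray \<open>t h'\<close>, \<open>t > 0\<close>. If \<open>F = \<Sum>r. f r\<close> lies between
  them, write \<open>D r = u r - f r\<close>, where \<open>u r\<close> is the \<open>r\<close>-th summand of the upper bound. Changing one
  coordinate of \<open>h'\<close> shows that \<open>D r\<close> is minimal at \<open>h' r\<close>, and on the ray the sum of the \<open>D r\<close>
  vanishes, so each \<open>D r\<close> is constant along the ray. This settles the arguments \<open>x > 0\<close> if \<open>h' r > 0\<close>.
  If column \<open>r\<close> carries no weight, let \<open>t\<close> tend to infinity in all other coordinates: the gap between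
  the upper bound and the loss vanishes in the limit. If it carries weight, then \<open>f r 0 = \<infinity>\<close>
  follows by letting \<open>t\<close> tend to 0 instead.\<close>

section \<open>Extended-real arithmetic of single summands\<close>

lemma matrix_vector_nth: "(A *v x) $ i = (\<Sum>j\<in>UNIV. A $ i $ j * x $ j)"
  by (simp add: matrix_vector_mult_def)

text \<open>If \<open>a = 0\<close>, the product \<open>ereal a * E\<close> vanishes even for
  infinite \<open>E\<close>, so \<open>E\<close> has to be real only for \<open>a > 0\<close>. This
  form fits both the loss and the upper bound.\<close>

lemma summand_finite:
  assumes "0 \<le> a" "0 < a \<Longrightarrow> E = ereal e"
  shows "ereal a * elog a - ereal a + ereal y - ereal a * E = ereal (a * ln a - a + (y - a * e))"
  using assms by (cases "a = 0") (auto simp: elog_def zero_ereal_def[symmetric])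

lemma KL_summand_finite:
  assumes "0 \<le> a" "0 < a \<Longrightarrow> 0 < y"
  shows "ereal a * elog a - ereal a + ereal y - ereal a * elog y
    = ereal (a * ln a - a + (y - a * ln y))"
  using assms by (intro summand_finite) (simp_all add: elog_def)

lemma KL_summand_infinite:
  assumes "0 < a" "y \<le> 0"
  shows "ereal a * elog a - ereal a + ereal y - ereal a * elog y = \<infinity>"
  using assms by (auto simp: elog_def)

text \<open>In \<open>ereal\<close>, \<open>\<infinity> + -\<infinity>\<close> is
  \<open>\<infinity>\<close>, so a term \<open>-\<infinity>\<close> decides the sum only in the
  absence of \<open>\<infinity>\<close>.\<close>

lemma sum_ereal_eq_MInfty:
  fixes f :: "'a \<Rightarrow> ereal"
  assumes "finite A" "j \<in> A" "f j = -\<infinity>" "\<And>i. i \<in> A \<Longrightarrow> f i \<noteq> \<infinity>"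
  shows "sum f A = -\<infinity>"
proof -
  have "sum f (A - {j}) \<noteq> \<infinity>"
    using assms by (simp add: sum_Pinfty)
  then show ?thesis
    using assms by (simp add: sum.remove[of A j])
qed

section \<open>The upper bound at a fixed admissible iterate\<close>

locale admissible_iterate =
  fixes v :: "real ^ 'm" and W :: "real ^ 'r ^ 'm" and h' :: "real ^ 'r"
  assumes v_nonneg: "0 \<le> v $ i"
    and W_nonneg: "0 \<le> W $ i $ r"
    and iterate_nonneg: "0 \<le> h' $ r"
    and iterate_pos: "0 < v $ i \<Longrightarrow> 0 < (W *v h') $ i"
begin

abbreviation \<alpha> :: "'m \<Rightarrow> 'r \<Rightarrow> real" where
  "\<alpha> \<equiv> MU_weight W h'"

definition KL_const :: real where
  "KL_const = (\<Sum>i\<in>UNIV. v $ i * ln (v $ i) - v $ i)"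

text \<open>The share of coordinate \<open>r\<close> in the upper bound; \<open>KL_const\<close>
  belongs to no coordinate and is split equally.\<close>

definition u :: "'r \<Rightarrow> real \<Rightarrow> real" where
  "u r x = KL_const / CARD('r)
     + (\<Sum>i\<in>UNIV. W $ i $ r * x - v $ i * (\<alpha> i r * ln (W $ i $ r * x / \<alpha> i r)))"

text \<open>The coordinates in which the upper bound has a logarithmic singularity at 0.\<close>
definition S :: "'r set" where
  "S = {r. \<exists>i. 0 < v $ i \<and> 0 < \<alpha> i r}"

text \<open>The real function \<open>u r\<close> cannot express the value \<open>\<infinity>\<close>
  at 0, so it is inserted here.\<close>

definition eu :: "'r \<Rightarrow> real \<Rightarrow> ereal" where
  "eu r x = (if r \<in> S \<and> x \<le> 0 then \<infinity> else ereal (u r x))"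

lemma mult_nonneg: "h \<in> nonneg_orthant \<Longrightarrow> 0 \<le> (W *v h) $ i"
  by (auto simp: matrix_vector_nth nonneg_orthant_def intro!: sum_nonneg mult_nonneg_nonneg W_nonneg)

lemma iterate_in_orthant: "h' \<in> nonneg_orthant"
  by (simp add: nonneg_orthant_def iterate_nonneg)

lemma weight_nonneg: "0 \<le> \<alpha> i r"
  unfolding MU_weight_def
  by (intro divide_nonneg_nonneg mult_nonneg_nonneg W_nonneg iterate_nonneg mult_nonneg iterate_in_orthant)

lemma weight_pos_D:
  assumes "0 < \<alpha> i r"
  shows "0 < W $ i $ r" "0 < h' $ r"
proof -
  have "W $ i $ r \<noteq> 0" "h' $ r \<noteq> 0"
    using assms by (auto simp: MU_weight_def)
  then show "0 < W $ i $ r" "0 < h' $ r"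
    using W_nonneg[of i r] iterate_nonneg[of r] by auto
qed

lemma sum_weight: "0 < v $ i \<Longrightarrow> (\<Sum>r\<in>UNIV. \<alpha> i r) = 1"
  using iterate_pos[of i]
  by (simp add: MU_weight_def sum_divide_distrib[symmetric] matrix_vector_nth[symmetric])

lemma S_iterate_pos: "r \<in> S \<Longrightarrow> 0 < h' $ r"
  by (auto simp: S_def dest: weight_pos_D)

text \<open>Such a coordinate enters the upper bound without a logarithm. It may still enter the
  logarithms of the loss, as \<open>W $ i $ r\<close> can be positive when
  \<open>h' $ r = 0\<close>.\<close>

lemma weight_outside_S:
  assumes "r \<notin> S" "0 < v $ i"
  shows "\<alpha> i r = 0" "W $ i $ r * h' $ r = 0"
proof -
  show "\<alpha> i r = 0"
    using assms weight_nonneg[of i r] by (fastforce simp: S_def)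
  then show "W $ i $ r * h' $ r = 0"
    using iterate_pos[OF assms(2)] by (auto simp: MU_weight_def)
qed

section \<open>Finite and infinite values, separability\<close>

lemma KL_finite:
  assumes "\<And>i. 0 < v $ i \<Longrightarrow> 0 < (W *v h) $ i"
  shows "KL_div v W h = ereal (KL_const + (\<Sum>i\<in>UNIV. (W *v h) $ i - v $ i * ln ((W *v h) $ i)))"
  unfolding KL_div_def KL_const_def
  by (simp only: KL_summand_finite[OF v_nonneg assms] sum_ereal sum.distrib)

lemma KL_infinite:
  assumes "0 < v $ i" "(W *v h) $ i \<le> 0"
  shows "KL_div v W h = \<infinity>"
  unfolding KL_div_def sum_Pinfty using KL_summand_infinite[OF assms] by auto

lemma sum_u:
  "(\<Sum>r\<in>UNIV. u r (h $ r)) = KL_const + (\<Sum>i\<in>UNIV. (W *v h) $ i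
      - v $ i * (\<Sum>r\<in>UNIV. \<alpha> i r * ln (W $ i $ r * h $ r / \<alpha> i r)))"
proof -
  have "(\<Sum>r\<in>UNIV. u r (h $ r)) = KL_const + (\<Sum>r\<in>UNIV. \<Sum>i\<in>UNIV. W $ i $ r * h $ r
      - v $ i * (\<alpha> i r * ln (W $ i $ r * h $ r / \<alpha> i r)))"
    by (simp add: u_def sum.distrib)
  also have "(\<Sum>r\<in>UNIV. \<Sum>i\<in>UNIV. W $ i $ r * h $ r
      - v $ i * (\<alpha> i r * ln (W $ i $ r * h $ r / \<alpha> i r)))
    = (\<Sum>i\<in>UNIV. \<Sum>r\<in>UNIV. W $ i $ r * h $ r
      - v $ i * (\<alpha> i r * ln (W $ i $ r * h $ r / \<alpha> i r)))"
    by (rule sum.swap)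
  finally show ?thesis
    by (simp add: sum_subtractf sum_distrib_left matrix_vector_nth)
qed

text \<open>A vanishing coordinate in \<open>S\<close> makes a row infinite on the left and a
  summand infinite on the right. Otherwise all terms are real and \<open>sum_u\<close> regroups the
  double sum by columns.\<close>

lemma UB_eq_sum_eu:
  assumes h: "h \<in> nonneg_orthant"
  shows "UB_MU v W h h' = (\<Sum>r\<in>UNIV. eu r (h $ r))"
proof (cases "\<exists>r\<in>S. h $ r \<le> 0")
  case True
  then obtain r i where r: "h $ r \<le> 0" "r \<in> S" "0 < v $ i" "0 < \<alpha> i r"
    by (auto simp: S_def)
  have arg: "W $ i $ r * h $ r / \<alpha> i r \<le> 0"
    using r W_nonneg[of i r] by (intro divide_nonpos_pos mult_nonneg_nonpos) auto
  have "(\<Sum>r\<in>UNIV. ereal (\<alpha> i r) * elog (W $ i $ r * h $ r / \<alpha> i r)) = -\<infinity>"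
  proof (rule sum_ereal_eq_MInfty[where j = r])
    show "ereal (\<alpha> i r) * elog (W $ i $ r * h $ r / \<alpha> i r) = -\<infinity>"
      using arg r by (simp add: elog_def)
    show "ereal (\<alpha> i s) * elog (W $ i $ s * h $ s / \<alpha> i s) \<noteq> \<infinity>" for s
      using weight_nonneg[of i s] by (cases "\<alpha> i s = 0") (auto simp: elog_def zero_ereal_def[symmetric])
  qed auto
  then have "UB_MU v W h h' = \<infinity>"
    unfolding UB_MU_def sum_Pinfty using r by (auto simp: elog_def intro!: exI[of _ i])
  moreover have "(\<Sum>r\<in>UNIV. eu r (h $ r)) = \<infinity>"
    unfolding sum_Pinfty using r by (auto simp: eu_def intro!: exI[of _ r])
  ultimately show ?thesis by simp
next
  case False
  have "(\<Sum>r\<in>UNIV. ereal (\<alpha> i r) * elog (W $ i $ r * h $ r / \<alpha> i r))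
      = ereal (\<Sum>r\<in>UNIV. \<alpha> i r * ln (W $ i $ r * h $ r / \<alpha> i r))" if "0 < v $ i" for i
    unfolding sum_ereal[symmetric]
  proof (rule sum.cong[OF refl])
    fix r
    show "ereal (\<alpha> i r) * elog (W $ i $ r * h $ r / \<alpha> i r)
      = ereal (\<alpha> i r * ln (W $ i $ r * h $ r / \<alpha> i r))"
    proof (cases "\<alpha> i r = 0")
      case True
      then show ?thesis by (simp add: zero_ereal_def[symmetric])
    next
      case alpha: False
      then have a: "0 < \<alpha> i r" using weight_nonneg[of i r] by simp
      with that have "r \<in> S" by (auto simp: S_def)
      with False have "0 < h $ r" by auto
      with weight_pos_D[OF a] a have "0 < W $ i $ r * h $ r / \<alpha> i r" by simp
      then show ?thesis by (simp add: elog_def)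
    qed
  qed
  then have "UB_MU v W h h' = ereal (\<Sum>r\<in>UNIV. u r (h $ r))"
    unfolding UB_MU_def sum_u KL_const_def
    by (simp only: summand_finite[OF v_nonneg] sum_ereal sum.distrib)
  moreover have "(\<Sum>r\<in>UNIV. eu r (h $ r)) = ereal (\<Sum>r\<in>UNIV. u r (h $ r))"
    unfolding sum_ereal[symmetric] using False by (intro sum.cong) (auto simp: eu_def)
  ultimately show ?thesis by simp
qed

lemma UB_finite:
  assumes "h \<in> nonneg_orthant" "\<And>r. r \<in> S \<Longrightarrow> 0 < h $ r"
  shows "UB_MU v W h h' = ereal (\<Sum>r\<in>UNIV. u r (h $ r))"
proof -
  have "eu r (h $ r) = ereal (u r (h $ r))" for r
    using assms(2)[of r] by (auto simp: eu_def)
  then show ?thesis by (simp add: UB_eq_sum_eu[OF assms(1)])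
qed

text \<open>The weights of row \<open>i\<close> sum to 1, so one of them is positive; its column
  lies in \<open>S\<close> and already contributes a positive term.\<close>

lemma mult_pos:
  assumes "h \<in> nonneg_orthant" "\<And>r. r \<in> S \<Longrightarrow> 0 < h $ r" "0 < v $ i"
  shows "0 < (W *v h) $ i"
proof -
  have "(\<Sum>r\<in>UNIV. \<alpha> i r) \<noteq> 0" using sum_weight[OF assms(3)] by simp
  then obtain r where "\<alpha> i r \<noteq> 0" by (meson sum.neutral)
  then have a: "0 < \<alpha> i r" using weight_nonneg[of i r] by simp
  then have "0 < h $ r" using assms by (auto simp: S_def)
  then have "0 < W $ i $ r * h $ r" using weight_pos_D[OF a] by simp
  then show ?thesis
    using assms(1) unfolding matrix_vector_nth
    by (intro sum_pos2[of _ r]) (auto simp: nonneg_orthant_def intro!: mult_nonneg_nonneg W_nonneg)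
qed

section \<open>Jensen's inequality and its equality case\<close>

text \<open>The tangent to \<open>ln\<close> at \<open>(W *v h) $ i\<close> bounds each logarithm.
  Multiplied by the weights, and with the nonnegative terms of the columns of weight 0 added, these
  bounds sum to \<open>1 - 1 = 0\<close>.\<close>

lemma jensen:
  assumes h: "h \<in> nonneg_orthant" "\<And>r. r \<in> S \<Longrightarrow> 0 < h $ r" and v: "0 < v $ i"
  shows "(\<Sum>r\<in>UNIV. \<alpha> i r * ln (W $ i $ r * h $ r / \<alpha> i r)) \<le> ln ((W *v h) $ i)"
proof -
  let ?y = "(W *v h) $ i"
  have y: "0 < ?y" by (rule mult_pos[OF h v])
  have "\<alpha> i r * (ln (W $ i $ r * h $ r / \<alpha> i r) - ln ?y) \<le> W $ i $ r * h $ r / ?y - \<alpha> i r" for r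
  proof (cases "\<alpha> i r = 0")
    case True
    then show ?thesis
      using h(1) y W_nonneg[of i r] by (simp add: nonneg_orthant_def)
  next
    case False
    then have a: "0 < \<alpha> i r" using weight_nonneg[of i r] by simp
    with v have "0 < h $ r" using h(2) by (auto simp: S_def)
    then have x: "0 < W $ i $ r * h $ r / \<alpha> i r" using weight_pos_D[OF a] a by simp
    then have "ln (W $ i $ r * h $ r / \<alpha> i r) - ln ?y \<le> (W $ i $ r * h $ r / \<alpha> i r - ?y) / ?y"
      using y by (rule ln_diff_le)
    also have "\<dots> = W $ i $ r * h $ r / \<alpha> i r / ?y - 1"
      using y by (simp add: diff_divide_distrib)
    finally show ?thesis
      using mult_left_mono[OF _ less_imp_le[OF a]] a by (fastforce simp: field_simps)
  qed
  then have "(\<Sum>r\<in>UNIV. \<alpha> i r * (ln (W $ i $ r * h $ r / \<alpha> i r) - ln ?y))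
    \<le> (\<Sum>r\<in>UNIV. W $ i $ r * h $ r / ?y - \<alpha> i r)"
    by (rule sum_mono)
  also have "\<dots> = 0"
    using y by (simp add: sum_subtractf sum_weight[OF v] sum_divide_distrib[symmetric] matrix_vector_nth[symmetric])
  finally show ?thesis
    by (simp add: right_diff_distrib sum_subtractf sum_distrib_right[symmetric] sum_weight[OF v])
qed

lemma global_majorant_UB: "global_majorant (KL_div v W) (\<lambda>h. UB_MU v W h h')"
  unfolding global_majorant_def
proof
  fix h :: "real ^ 'r" assume h: "h \<in> nonneg_orthant"
  show "KL_div v W h \<le> UB_MU v W h h'"
  proof (cases "\<forall>r\<in>S. 0 < h $ r")
    case True
    have "v $ i * (\<Sum>r\<in>UNIV. \<alpha> i r * ln (W $ i $ r * h $ r / \<alpha> i r)) \<le> v $ i * ln ((W *v h) $ i)" for i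
      using jensen[OF h, of i] True v_nonneg[of i] by (cases "v $ i = 0") (auto intro: mult_left_mono)
    then show ?thesis
      using True by (simp add: UB_finite[OF h] KL_finite[OF mult_pos[OF h]] sum_u sum_mono)
  next
    case False
    then obtain r where "eu r (h $ r) = \<infinity>"
      by (auto simp: eu_def not_less)
    then have "(\<Sum>r\<in>UNIV. eu r (h $ r)) = \<infinity>"
      unfolding sum_Pinfty by auto
    then show ?thesis by (simp add: UB_eq_sum_eu[OF h])
  qed
qed

lemma separable_UB: "separable (\<lambda>h. UB_MU v W h h')"
  unfolding separable_def
  by (rule exI[of _ eu]) (auto simp: UB_eq_sum_eu eu_def)

lemma KL_le_ereal_D:
  assumes "KL_div v W h \<le> ereal K"
  shows "0 < v $ i \<Longrightarrow> 0 < (W *v h) $ i"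
    and "KL_const + (\<Sum>i\<in>UNIV. (W *v h) $ i - v $ i * ln ((W *v h) $ i)) \<le> K"
proof -
  have pos: "0 < (W *v h) $ i" if "0 < v $ i" for i
    using assms KL_infinite[OF that, of h] by (force simp: not_less)
  then show "0 < v $ i \<Longrightarrow> 0 < (W *v h) $ i" by blast
  show "KL_const + (\<Sum>i\<in>UNIV. (W *v h) $ i - v $ i * ln ((W *v h) $ i)) \<le> K"
    using assms by (simp add: KL_finite[OF pos])
qed

text \<open>On the ray, \<open>h' $ s\<close> cancels against the weight and the argument of
  \<open>ln\<close> no longer depends on \<open>s\<close>: the equality case of Jensen. The premise
  is restricted to nonzero weights because a coordinate of weight 0 is later moved off the
  ray.\<close>

lemma weight_log_scaled:
  assumes "0 < v $ i" "\<alpha> i s \<noteq> 0 \<Longrightarrow> x = t * h' $ s"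
  shows "\<alpha> i s * ln (W $ i $ s * x / \<alpha> i s) = \<alpha> i s * ln (t * (W *v h') $ i)"
proof (cases "\<alpha> i s = 0")
  case False
  then have a: "0 < \<alpha> i s" using weight_nonneg[of i s] by simp
  have "W $ i $ s * x / \<alpha> i s = t * (W *v h') $ i"
    using assms(2)[OF False] weight_pos_D[OF a] iterate_pos[OF assms(1)]
    by (simp add: MU_weight_def)
  then show ?thesis by simp
qed simp

lemma sum_weight_log_scaled:
  assumes "0 < v $ i" "\<And>s. \<alpha> i s \<noteq> 0 \<Longrightarrow> h $ s = t * h' $ s"
  shows "(\<Sum>s\<in>UNIV. \<alpha> i s * ln (W $ i $ s * h $ s / \<alpha> i s)) = ln (t * (W *v h') $ i)"
proof -
  have "(\<Sum>s\<in>UNIV. \<alpha> i s * ln (W $ i $ s * h $ s / \<alpha> i s))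
      = (\<Sum>s\<in>UNIV. \<alpha> i s * ln (t * (W *v h') $ i))"
    by (rule sum.cong[OF refl weight_log_scaled[OF assms]])
  then show ?thesis
    by (simp add: sum_distrib_right[symmetric] sum_weight[OF assms(1)])
qed

end

lemma le_0_if_le_divide:
  fixes a K :: real
  assumes "\<And>t. 0 < t \<Longrightarrow> a \<le> K / t"
  shows "a \<le> 0"
proof (rule ccontr)
  assume "\<not> a \<le> 0"
  then have a: "0 < a" by simp
  \<comment> \<open>For this \<open>t\<close>, \<open>K / t = a * K / (\<bar>K\<bar> + 1)\<close> is
    smaller than \<open>a\<close>.\<close>
  have "a \<le> K / ((\<bar>K\<bar> + 1) / a)"
    using a by (intro assms) (simp add: divide_pos_pos add_nonneg_pos)
  then have "a + a * \<bar>K\<bar> \<le> a * K"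
    using a by (simp add: field_simps)
  moreover have "a * K \<le> a * \<bar>K\<bar>"
    using a by (intro mult_left_mono) auto
  ultimately show False using a by linarith
qed

section \<open>A separable function between the loss and the upper bound\<close>

locale separable_majorant = admissible_iterate v W h'
  for v :: "real ^ 'm" and W :: "real ^ 'r ^ 'm" and h' :: "real ^ 'r" +
  fixes f :: "'r \<Rightarrow> real \<Rightarrow> ereal"
  assumes f_not_MInfty: "0 \<le> x \<Longrightarrow> f r x \<noteq> -\<infinity>"
    and f_ge: "h \<in> nonneg_orthant \<Longrightarrow> KL_div v W h \<le> (\<Sum>r\<in>UNIV. f r (h $ r))"
    and f_le: "h \<in> nonneg_orthant \<Longrightarrow> (\<Sum>r\<in>UNIV. f r (h $ r)) \<le> UB_MU v W h h'"
begin

text \<open>The nonnegative arguments at which \<open>eu r\<close> is finite; on the product of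
  these sets the comparison takes place in the reals.\<close>

definition dom :: "'r \<Rightarrow> real set" where
  "dom r = {x. 0 \<le> x \<and> (r \<in> S \<longrightarrow> 0 < x)}"

definition \<phi> :: "'r \<Rightarrow> real \<Rightarrow> real" where
  "\<phi> r x = real_of_ereal (f r x)"

definition D :: "'r \<Rightarrow> real \<Rightarrow> real" where
  "D r x = u r x - \<phi> r x"

text \<open>The test points of the proof: they leave the ray through \<open>h'\<close> in one
  coordinate only, so that known sums over the ray isolate the summand \<open>r\<close>.\<close>

definition ray_except :: "'r \<Rightarrow> real \<Rightarrow> real \<Rightarrow> real ^ 'r" where
  "ray_except r x t = (\<chi> s. if s = r then x else t * h' $ s)"

lemma ray_dom: "0 < t \<Longrightarrow> t * h' $ s \<in> dom s"
  using iterate_nonneg[of s] S_iterate_pos[of s] by (auto simp: dom_def)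

lemma ray_except_dom: "0 < t \<Longrightarrow> x \<in> dom r \<Longrightarrow> ray_except r x t $ s \<in> dom s"
  by (auto simp: ray_except_def ray_dom)

lemma ray_except_orthant: "0 < t \<Longrightarrow> 0 \<le> x \<Longrightarrow> ray_except r x t \<in> nonneg_orthant"
  using iterate_nonneg by (auto simp: ray_except_def nonneg_orthant_def)

lemma mult_ray_except:
  "(W *v ray_except r x t) $ i = t * (W *v h') $ i + W $ i $ r * (x - t * h' $ r)"
proof -
  have "(W *v ray_except r x t) $ i = (\<Sum>s\<in>UNIV. t * (W $ i $ s * h' $ s)
      + (if s = r then W $ i $ r * (x - t * h' $ r) else 0))"
    unfolding matrix_vector_nth by (rule sum.cong) (auto simp: ray_except_def algebra_simps)
  then show ?thesis
    by (simp add: sum.distrib sum_distrib_left matrix_vector_nth)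
qed

lemma sum_ray_except:
  fixes g :: "'r \<Rightarrow> real \<Rightarrow> 'b :: ab_group_add"
  shows "(\<Sum>s\<in>UNIV. g s (ray_except r x t $ s)) = g r x + ((\<Sum>s\<in>UNIV. g s (t * h' $ s)) - g r (t * h' $ r))"
proof -
  have "(\<Sum>s\<in>UNIV - {r}. g s (ray_except r x t $ s)) = (\<Sum>s\<in>UNIV - {r}. g s (t * h' $ s))"
    by (rule sum.cong) (auto simp: ray_except_def)
  then show ?thesis
    by (simp add: sum.remove[of UNIV r] ray_except_def)
qed

lemma dom_orthant: "(\<And>r. h $ r \<in> dom r) \<Longrightarrow> h \<in> nonneg_orthant"
  by (simp add: dom_def nonneg_orthant_def)

lemma UB_dom: "(\<And>r. h $ r \<in> dom r) \<Longrightarrow> UB_MU v W h h' = ereal (\<Sum>r\<in>UNIV. u r (h $ r))"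
  by (rule UB_finite) (auto simp: dom_def nonneg_orthant_def)

text \<open>Completing \<open>x\<close> by the other coordinates of \<open>h'\<close> gives a point
  where the upper bound is finite. A summand \<open>\<infinity>\<close> would make the sum infinite
  there.\<close>

lemma f_eq_ereal:
  assumes x: "x \<in> dom r"
  shows "f r x = ereal (\<phi> r x)"
proof -
  let ?h = "ray_except r x 1"
  have h: "?h $ s \<in> dom s" for s using x by (simp add: ray_except_dom)
  have "(\<Sum>s\<in>UNIV. f s (?h $ s)) \<noteq> \<infinity>"
    using f_le[OF dom_orthant[OF h]] UB_dom[OF h] by auto
  then have "f r (?h $ r) \<noteq> \<infinity>"
    unfolding sum_Pinfty by auto
  then have "\<bar>f r x\<bar> \<noteq> \<infinity>"
    using x f_not_MInfty[of x r] by (auto simp: ray_except_def dom_def)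
  then show ?thesis by (simp add: \<phi>_def ereal_real')
qed

lemma sum_f_dom: "(\<And>r. h $ r \<in> dom r) \<Longrightarrow> (\<Sum>r\<in>UNIV. f r (h $ r)) = ereal (\<Sum>r\<in>UNIV. \<phi> r (h $ r))"
  by (simp add: f_eq_ereal)

lemma sum_D_nonneg: "(\<And>r. h $ r \<in> dom r) \<Longrightarrow> 0 \<le> (\<Sum>r\<in>UNIV. D r (h $ r))"
  using f_le[OF dom_orthant, of h] by (simp add: sum_f_dom UB_dom D_def sum_subtractf)

text \<open>Constants and linear terms of the loss and of the upper bound cancel, which leaves the
  gap in Jensen's inequality.\<close>

lemma sum_D_le_gap:
  assumes h: "\<And>r. h $ r \<in> dom r"
  shows "(\<Sum>r\<in>UNIV. D r (h $ r)) \<le> (\<Sum>i\<in>UNIV. v $ i * (ln ((W *v h) $ i)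
    - (\<Sum>r\<in>UNIV. \<alpha> i r * ln (W $ i $ r * h $ r / \<alpha> i r))))"
proof -
  have "KL_div v W h \<le> ereal (\<Sum>r\<in>UNIV. \<phi> r (h $ r))"
    using f_ge[OF dom_orthant[OF h]] by (simp add: sum_f_dom h)
  from KL_le_ereal_D(2)[OF this] show ?thesis
    unfolding D_def sum_subtractf sum_u by (simp add: sum_subtractf right_diff_distrib)
qed

lemma sum_D_ray:
  assumes "0 < t"
  shows "(\<Sum>r\<in>UNIV. D r (t * h' $ r)) = 0"
proof (rule antisym)
  let ?h = "t *s h'"
  have h: "?h $ r \<in> dom r" for r using ray_dom[OF assms] by simp
  have gap: "v $ i * (ln ((W *v ?h) $ i)
      - (\<Sum>r\<in>UNIV. \<alpha> i r * ln (W $ i $ r * ?h $ r / \<alpha> i r))) = 0" for i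
  proof (cases "v $ i = 0")
    case False
    then have "0 < v $ i" using v_nonneg[of i] by simp
    from sum_weight_log_scaled[OF this, of ?h t] show ?thesis
      by (simp add: matrix_vector_nth sum_distrib_left mult_ac)
  qed simp
  show "(\<Sum>r\<in>UNIV. D r (t * h' $ r)) \<le> 0"
    using sum_D_le_gap[OF h] unfolding gap by simp
  show "0 \<le> (\<Sum>r\<in>UNIV. D r (t * h' $ r))"
    using sum_D_nonneg[OF h] by simp
qed

section \<open>Constancy of the coordinate differences\<close>

lemma D_ge:
  assumes "x \<in> dom r"
  shows "D r (h' $ r) \<le> D r x"
  using sum_D_nonneg[OF ray_except_dom[OF _ assms], of 1] sum_D_ray[of 1]
  by (simp add: sum_ray_except)

lemma D_ray:
  assumes "0 < t"
  shows "D r (t * h' $ r) = D r (h' $ r)"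
proof -
  have "(\<Sum>r\<in>UNIV. D r (h' $ r)) = (\<Sum>r\<in>UNIV. D r (t * h' $ r))"
    using sum_D_ray[OF assms] sum_D_ray[of 1] by simp
  \<comment> \<open>Every summand is at least its value at \<open>h'\<close> and the two sums agree,
    so the summands agree.\<close>
  from sum_mono_inv[OF this D_ge[OF ray_dom[OF assms]], of r] show ?thesis by simp
qed

lemma D_outside_S:
  assumes r: "r \<notin> S" and x: "0 \<le> x"
  shows "D r x = D r (h' $ r)"
proof (rule antisym)
  have dom: "x \<in> dom r" using assms by (simp add: dom_def)
  show "D r (h' $ r) \<le> D r x" by (rule D_ge[OF dom])
  \<comment> \<open>Comes from \<open>ln (t * y + b) - ln (t * y) \<le> b / (t * y)\<close> with
    \<open>b = W $ i $ r * x\<close>, multiplied by \<open>v $ i\<close> and summed over the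
    rows.\<close>
  define K where "K = (\<Sum>i\<in>UNIV. v $ i * (W $ i $ r * x / (W *v h') $ i))"
  have "D r x - D r (h' $ r) \<le> K / t" if t: "0 < t" for t
  proof -
    let ?h = "ray_except r x t"
    have "v $ i * (ln ((W *v ?h) $ i) - (\<Sum>s\<in>UNIV. \<alpha> i s * ln (W $ i $ s * ?h $ s / \<alpha> i s)))
      \<le> v $ i * (W $ i $ r * x / (W *v h') $ i) / t" for i
    proof (cases "v $ i = 0")
      case False
      then have v: "0 < v $ i" using v_nonneg[of i] by simp
      let ?y = "(W *v h') $ i"
      have y: "0 < t * ?y" using iterate_pos[OF v] t by simp
      have b: "0 \<le> W $ i $ r * x" using W_nonneg x by simp
      \<comment> \<open>Hence removing \<open>t * h' $ r\<close> from coordinate \<open>r\<close>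
        does not change row \<open>i\<close>.\<close>
      have "W $ i $ r = 0 \<or> h' $ r = 0" using weight_outside_S(2)[OF r v] by simp
      then have "(W *v ?h) $ i = t * ?y + W $ i $ r * x"
        unfolding mult_ray_except by auto
      moreover have "(\<Sum>s\<in>UNIV. \<alpha> i s * ln (W $ i $ s * ?h $ s / \<alpha> i s)) = ln (t * ?y)"
        using weight_outside_S(1)[OF r v]
        by (intro sum_weight_log_scaled[OF v]) (auto simp: ray_except_def)
      moreover have "ln (t * ?y + W $ i $ r * x) - ln (t * ?y) \<le> W $ i $ r * x / (t * ?y)"
        using ln_diff_le[of "t * ?y + W $ i $ r * x" "t * ?y"] y b by simp
      ultimately have "ln ((W *v ?h) $ i) - (\<Sum>s\<in>UNIV. \<alpha> i s * ln (W $ i $ s * ?h $ s / \<alpha> i s))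
          \<le> W $ i $ r * x / ?y / t"
        by (simp add: mult.commute)
      from mult_left_mono[OF this v_nonneg[of i]] show ?thesis by simp
    qed simp
    then have "(\<Sum>s\<in>UNIV. D s (?h $ s)) \<le> K / t"
      unfolding K_def sum_divide_distrib
      by (intro order_trans[OF sum_D_le_gap[OF ray_except_dom[OF t dom]]] sum_mono)
    \<comment> \<open>By \<open>D_ray\<close> the other coordinates contribute their values at
      \<open>h'\<close>, which sum to \<open>- D r (h' $ r)\<close>.\<close>
    then show ?thesis
      using sum_D_ray[of 1] unfolding sum_ray_except D_ray[OF t] by simp
  qed
  then show "D r x \<le> D r (h' $ r)"
    using le_0_if_le_divide[of "D r x - D r (h' $ r)" K] by simp
qed

lemma D_const:
  assumes "x \<in> dom r"
  shows "D r x = D r (h' $ r)"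
proof (cases "r \<in> S")
  case True
  \<comment> \<open>For \<open>r\<close> in \<open>S\<close> the ray itself reaches every positive
    \<open>x\<close>, at \<open>t = x / h' $ r\<close>.\<close>
  then have "0 < x / h' $ r" "h' $ r \<noteq> 0"
    using assms S_iterate_pos[of r] by (auto simp: dom_def)
  then show ?thesis using D_ray[of "x / h' $ r" r] by simp
next
  case False
  then show ?thesis using assms D_outside_S by (simp add: dom_def)
qed

text \<open>With the \<open>r\<close>-th coordinate set to 0, both sides grow like a multiple of \<open>- ln t\<close> along
  \<open>t h'\<close>, \<open>t \<rightarrow> 0\<close>. The loss has the larger coefficient, as it does not lose the weights of column \<open>r\<close>.\<close>
lemma f_singular:
  assumes r: "r \<in> S"
  shows "f r 0 = \<infinity>"
proof (rule ccontr)
  assume "f r 0 \<noteq> \<infinity>"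
  then have f0: "f r 0 = ereal (\<phi> r 0)"
    using f_not_MInfty[of 0 r] by (cases "f r 0") (simp_all add: \<phi>_def)
  \<comment> \<open>These constants are what remains of the comparison at
    \<open>ray_except r 0 t\<close> once the linear terms and the logarithms of the full rows
    cancel; \<open>A\<close> is the weight carried by column \<open>r\<close>.\<close>
  define c where "c = \<phi> r 0 + D r (h' $ r) - KL_const / CARD('r)"
  define A where "A = (\<Sum>i\<in>UNIV. v $ i * \<alpha> i r)"
  define B where "B = (\<Sum>i\<in>UNIV. v $ i * (\<alpha> i r * ln ((W *v h') $ i)))"
  have le: "0 \<le> c + A * ln t + B" if t: "0 < t" for t
  proof -
    let ?h = "ray_except r 0 t"
    let ?y = "\<lambda>i. (W *v h') $ i"
    have "f s (?h $ s) = ereal (\<phi> s (?h $ s))" for s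
      using f0 f_eq_ereal[OF ray_dom[OF t]] by (cases "s = r") (simp_all add: ray_except_def)
    then have "KL_div v W ?h \<le> ereal (\<Sum>s\<in>UNIV. \<phi> s (?h $ s))"
      using f_ge[OF ray_except_orthant[OF t order_refl], of r] by simp
    note KL = KL_le_ereal_D[OF this]
    have "v $ i * ln ((W *v ?h) $ i) \<le> v $ i * ln (t * ?y i)" for i
    proof (cases "v $ i = 0")
      case False
      then have v: "0 < v $ i" using v_nonneg[of i] by simp
      \<comment> \<open>Dropping coordinate \<open>r\<close> can only lower the row, and
        \<open>KL(1)\<close> keeps it positive, so monotonicity of \<open>ln\<close>
        applies.\<close>
      have "(W *v ?h) $ i \<le> t * ?y i"
        unfolding mult_ray_except using t W_nonneg[of i r] iterate_nonneg[of r] by simp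
      then show ?thesis
        using KL(1)[OF v] v by (intro mult_left_mono) simp_all
    qed simp
    then have "KL_const + (\<Sum>i\<in>UNIV. (W *v ?h) $ i - v $ i * ln (t * ?y i))
      \<le> (\<Sum>s\<in>UNIV. \<phi> s (?h $ s))"
      by (intro order_trans[OF _ KL(2)] add_left_mono sum_mono diff_left_mono)
    also have "\<dots> = \<phi> r 0 + ((\<Sum>s\<in>UNIV. \<phi> s (t * h' $ s)) - \<phi> r (t * h' $ r))"
      by (rule sum_ray_except)
    also have "(\<Sum>s\<in>UNIV. \<phi> s (t * h' $ s)) = (\<Sum>s\<in>UNIV. u s (t * h' $ s))"
      using sum_D_ray[OF t] by (simp add: D_def sum_subtractf)
    also have "\<dots> = KL_const + (\<Sum>i\<in>UNIV. t * ?y i - v $ i * ln (t * ?y i))"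
    proof -
      have log: "v $ i * (\<Sum>s\<in>UNIV. \<alpha> i s * ln (W $ i $ s * (t *s h') $ s / \<alpha> i s)) = v $ i * ln (t * ?y i)" for i
        using sum_weight_log_scaled[of i "t *s h'" t] v_nonneg[of i] by (cases "v $ i = 0") simp_all
      have "(W *v (t *s h')) $ i = t * ?y i" for i
        by (simp add: matrix_vector_nth sum_distrib_left mult_ac)
      then show ?thesis using sum_u[of "t *s h'"] unfolding log by simp
    qed
    also have "\<phi> r (t * h' $ r) = u r (t * h' $ r) - D r (h' $ r)"
      using D_ray[OF t, of r] by (simp add: D_def)
    also have "u r (t * h' $ r) = KL_const / CARD('r)
        + (\<Sum>i\<in>UNIV. W $ i $ r * (t * h' $ r) - (v $ i * \<alpha> i r * ln t + v $ i * (\<alpha> i r * ln (?y i))))"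
    proof -
      have "v $ i * (\<alpha> i r * ln (W $ i $ r * (t * h' $ r) / \<alpha> i r))
        = v $ i * \<alpha> i r * ln t + v $ i * (\<alpha> i r * ln (?y i))" for i
      proof (cases "v $ i = 0")
        case False
        then have v: "0 < v $ i" using v_nonneg[of i] by simp
        show ?thesis
          using weight_log_scaled[OF v, of r "t * h' $ r" t] iterate_pos[OF v] t
          by (simp add: ln_mult_pos algebra_simps)
      qed simp
      then show ?thesis unfolding u_def by simp
    qed
    finally show ?thesis
      unfolding mult_ray_except c_def A_def B_def
      by (simp add: sum.distrib sum_subtractf sum_negf sum_distrib_right)
  qed
  obtain i where i: "0 < v $ i" "0 < \<alpha> i r" using r by (auto simp: S_def)
  have A: "0 < A"
    unfolding A_def using i by (intro sum_pos2[of _ i]) (simp_all add: v_nonneg weight_nonneg)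
  \<comment> \<open>The exponent is chosen to make the right-hand side equal to -1.\<close>
  have "0 \<le> c + A * (- (c + B + 1) / A) + B"
    using le[of "exp (- (c + B + 1) / A)"] by (simp only: ln_exp exp_gt_zero)
  then show False using A by simp
qed

lemma sum_f_eq_UB:
  assumes h: "h \<in> nonneg_orthant"
  shows "(\<Sum>r\<in>UNIV. f r (h $ r)) = UB_MU v W h h'"
proof (cases "\<forall>r\<in>S. 0 < h $ r")
  case True
  then have dom: "h $ r \<in> dom r" for r using h by (simp add: dom_def nonneg_orthant_def)
  have "(\<Sum>r\<in>UNIV. D r (h $ r)) = 0"
    using sum_D_ray[of 1] by (simp add: D_const[OF dom])
  then show ?thesis
    by (simp add: sum_f_dom[OF dom] UB_dom[OF dom] D_def sum_subtractf)
next
  case False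
  then obtain r where "r \<in> S" "h $ r = 0"
    using h by (force simp: nonneg_orthant_def not_less intro: antisym)
  then have "(\<Sum>r\<in>UNIV. f r (h $ r)) = \<infinity>"
    unfolding sum_Pinfty using f_singular[of r] by (auto intro!: exI[of _ r])
  \<comment> \<open>As the sum is infinite, \<open>f_le\<close> forces the upper bound to be
    infinite too.\<close>
  then show ?thesis using f_le[OF h] by simp
qed

end

section \<open>Tightness and the real-valued case\<close>

lemma (in admissible_iterate) tightest_UB:
  "tightest_separable_majorant (KL_div v W) (\<lambda>h. UB_MU v W h h')"
  unfolding tightest_separable_majorant_def
proof (intro conjI allI impI ballI separable_UB global_majorant_UB)
  fix F and h :: "real ^ 'r"
  assume F: "separable F \<and> global_majorant (KL_div v W) F
      \<and> (\<forall>h\<in>nonneg_orthant. F h \<le> UB_MU v W h h')"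
    and h: "h \<in> nonneg_orthant"
  from F obtain f where f: "\<forall>r. \<forall>x\<ge>0. f r x \<noteq> -\<infinity>"
      "\<forall>h\<in>nonneg_orthant. F h = (\<Sum>r\<in>UNIV. f r (h $ r))"
    by (auto simp: separable_def)
  interpret separable_majorant v W h' f
    using F f by unfold_locales (auto simp: global_majorant_def)
  show "F h = UB_MU v W h h'"
    using sum_f_eq_UB[OF h] f(2) h by simp
qed

text \<open>At \<open>h = 0\<close> every row of \<open>W *v h\<close> vanishes, so a row with
  \<open>v $ i > 0\<close> has infinite loss.\<close>

lemma v_zero_if_KL_real_bounded_at_zero:
  assumes "v \<in> nonneg_orthant" "KL_div v W 0 \<le> ereal K"
  shows "v = 0"
proof (rule ccontr)
  assume "v \<noteq> 0"
  then obtain i where "0 < v $ i"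
    using assms(1) by (auto simp: vec_eq_iff nonneg_orthant_def less_le)
  then have "KL_div v W 0 = \<infinity>"
    unfolding KL_div_def sum_Pinfty
    using KL_summand_infinite[of "v $ i" "(W *v 0) $ i"] by auto
  with assms(2) show False by simp
qed

text \<open>The functions \<open>g\<close> of the first part are real-valued, so the lower bound at \<open>h = 0\<close> forces \<open>v = 0\<close>,
  and then the loss and the upper bound are the same linear function.\<close>
theorem proposition3p2:
  fixes v :: "real ^ 'm" and W :: "real ^ 'r ^ 'm"
  assumes v_nonneg: "v \<in> nonneg_orthant"
    and W_nonneg: "\<And>i r. 0 \<le> W $ i $ r"
  shows
    "(\<forall>g :: 'r \<Rightarrow> real \<Rightarrow> real.
        (\<forall>r. \<forall>x\<ge>0. 0 \<le> g r x) \<longrightarrow>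
        (\<forall>h\<in>nonneg_orthant. \<forall>h'\<in>nonneg_orthant.
           KL_div v W h \<le> ereal (\<Sum>r\<in>UNIV. g r (h $ r)) \<and>
           ereal (\<Sum>r\<in>UNIV. g r (h $ r)) \<le> UB_MU v W h h') \<longrightarrow>
        (\<forall>h\<in>nonneg_orthant. \<forall>h'\<in>nonneg_orthant.
           ereal (\<Sum>r\<in>UNIV. g r (h $ r)) = UB_MU v W h h')) \<and>
     (\<forall>h'. MU_admissible v W h' \<longrightarrow>
        tightest_separable_majorant (KL_div v W) (\<lambda>h. UB_MU v W h h'))"
proof (intro conjI allI impI ballI)
  fix g :: "'r \<Rightarrow> real \<Rightarrow> real" and h h' :: "real ^ 'r"
  assume bounds: "\<forall>h\<in>nonneg_orthant. \<forall>h'\<in>nonneg_orthant.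
           KL_div v W h \<le> ereal (\<Sum>r\<in>UNIV. g r (h $ r)) \<and>
           ereal (\<Sum>r\<in>UNIV. g r (h $ r)) \<le> UB_MU v W h h'"
    and h: "h \<in> nonneg_orthant" "h' \<in> nonneg_orthant"
  have "(0 :: real ^ 'r) \<in> nonneg_orthant" by (simp add: nonneg_orthant_def)
  then have "v = 0"
    using bounds v_zero_if_KL_real_bounded_at_zero[OF v_nonneg] by blast
  then have "KL_div v W h = UB_MU v W h h'"
    by (simp add: KL_div_def UB_MU_def zero_ereal_def[symmetric])
  then show "ereal (\<Sum>r\<in>UNIV. g r (h $ r)) = UB_MU v W h h'"
    using bounds h by (metis antisym)
next
  fix h' assume "MU_admissible v W h'"
  then interpret admissible_iterate v W h'
    using v_nonneg W_nonneg by unfold_locales (auto simp: MU_admissible_def nonneg_orthant_def)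
  show "tightest_separable_majorant (KL_div v W) (\<lambda>h. UB_MU v W h h')"
    by (rule tightest_UB)
qed

end
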